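(* Let $\{V_k(x,t)\}_{k\ge 0,\,t\ge0}$ be a Lévy-Sheffer system with generating function $$\sum_{k\ge0}V_k(x,t)\frac{z^k}{k!}=(g(z))^t\exp\{x\,u(z)\},$$ and let $\alpha$ and $\gamma$ be the umbrae with generating functions $f(\alpha,z)=g(z)$ and $f(\gamma,z)=1+u(z)$. Then, for every nonnegative integer $k$, the Lévy-Sheffer polynomials $\{V_k(x,t)\}_{t\ge0}$ are time-space harmonic with respect to Lévy processes umbrally represented by $$\{-t\mathbf{.}\alpha\mathbf{.}\beta\mathbf{.}\gamma^{<-1>}\}_{t\ge0},$$ that is, time-space harmonic with respect to this family of auxiliary umbrae, where $\gamma^{<-1>}$ is the compositional inverse of the umbra $\gamma$.
   Context: Lévy-Sheffer system: a sequence of polynomials $V_k(x,t)$ in $x$, $t\ge0$, defined by the generating function $\sum_{k\ge0}V_k(x,t)z^k/k!=(g(z))^t\exp\{xu(z)\}$, where $g$ and $u$ are analytic in a neighborhood of $z=0$, $u(0)=0$, $g(0)=1$, $u'(0)\ne0$, and $1/g(\tau(z))$ is an infinitely divisible moment generating function, with $\tau$ such that $\tau(u(z))=z$. An umbra $\alpha$ is a symbol representing a sequence $a_0=1,a_1,a_2,\ldots$ of real numbers through a linear evaluation functional $E$ with $E[\alpha^n]=a_n$ (the $n$-th moment); $E$ is linear over $\mathbb{R}[x]$, $E[1]=1$, and $E$ is multiplicative on monomials in distinct (uncorrelated) umbrae. Its generating function is the formal power series $f(\alpha,z)=\sum_{n\ge0}a_nz^n/n!$. Two umbrae are similar ($\equiv$)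 if they have the same moments. For $t\in\mathbb{R}$, $t\mathbf{.}\alpha$ is the auxiliary umbra with generating function $f(\alpha,z)^t$. A Lévy process $\{X_t\}_{t\ge0}$ is umbrally represented by the family $\{t\mathbf{.}\omega\}_{t\ge0}$ if $E[X_t^k]=E[(t\mathbf{.}\omega)^k]$ for all $k$ and $t$. The composition umbra $\alpha\mathbf{.}\beta\mathbf{.}\gamma$ is the auxiliary umbra with generating function $f(\alpha,f(\gamma,z)-1)$. The singleton umbra $\chi$ has $f(\chi,z)=1+z$. If $E[\gamma]\ne0$, the compositional inverse $\gamma^{<-1>}$ is the umbra with $\gamma\mathbf{.}\beta\mathbf{.}\gamma^{<-1>}\equiv\gamma^{<-1>}\mathbf{.}\beta\mathbf{.}\gamma\equiv\chi$. The umbra $-t\mathbf{.}\alpha\mathbf{.}\beta\mathbf{.}\gamma^{<-1>}$ is $(-t)\mathbf{.}\rho\equiv t\mathbf{.}\omega$ with $\rho=\alpha\mathbf{.}\beta\mathbf{.}\gamma^{<-1>}$ and $\omega=-1\mathbf{.}\rho$; its generating function is $f(\rho,z)^{-t}$. Conditional evaluation: for an umbra $\omega$ and $0\le s\le t$, $E[\,\cdot\mid s\mathbf{.}\omega]$ is the linear map from real polynomials in the symbol $t\mathbf{.}\omega$ to real polynomials in the symbol $s\mathbf{.}\omega$ (treated as an indeterminate) given by $E[(t\mathbf{.}\omega)^k\mid s\mathbf{.}\omega]=\sum_{j=0}^k\binom{k}{j}(s\mathbf{.}\omega)^j\,E[((t-s)\mathbf{.}\omega')^{k-j}]$, where $\omega'$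 is uncorrelated with $\omega$ and has the same moments. A family $\{P(x,t)\}_{t\ge0}\subset\mathbb{R}[x]$ is time-space harmonic with respect to $\{t\mathbf{.}\omega\}_{t\ge0}$ if $E[P(t\mathbf{.}\omega,t)\mid s\mathbf{.}\omega]=P(s\mathbf{.}\omega,s)$ for all $0\le s\le t$, as polynomials in the symbol $s\mathbf{.}\omega$. *)

theory Defs
  imports "HOL-Probability.Probability"
begin

section \<open>Umbrae\<close>

text \<open>
  Umbrae are identified when they are similar, so an umbra is its sequence of moments and
  similarity is equality.  The value \<open>moment \<alpha> n\<close> is \<open>E[\<alpha>^n]\<close>.
\<close>

typedef umbra = "{a :: nat \<Rightarrow> real. a 0 = 1}"
  morphisms moment Abs_umbra
  by (rule exI[of _ "\<lambda>_. 1"]) simp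

definition umbra_gf :: "umbra \<Rightarrow> real fps" where
  "umbra_gf \<alpha> = Abs_fps (\<lambda>n. moment \<alpha> n / fact n)"

text \<open>The auxiliary umbra with a prescribed generating function (of constant term 1).\<close>

definition umbra_of_gf :: "real fps \<Rightarrow> umbra" where
  "umbra_of_gf F = Abs_umbra (\<lambda>n. fact n * fps_nth F n)"

lemma umbra_gf_nth_0 [simp]: "fps_nth (umbra_gf \<alpha>) 0 = 1"
  using moment[of \<alpha>] by (simp add: umbra_gf_def)

lemma umbra_gf_umbra_of_gf: "fps_nth F 0 = 1 \<Longrightarrow> umbra_gf (umbra_of_gf F) = F"
  by (simp add: umbra_gf_def umbra_of_gf_def Abs_umbra_inverse fps_eq_iff)

lemma umbra_gf_inject: "umbra_gf \<alpha> = umbra_gf \<beta> \<longleftrightarrow> \<alpha> = \<beta>"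
  by (auto simp: umbra_gf_def fps_eq_iff moment_inject[symmetric])

text \<open>
  The real power \<open>F^t\<close> of a formal power series with constant term 1 is given by the
  binomial series \<open>(1 + y)^t = (\<Sum>n. (t gchoose n) y^n)\<close> with \<open>y = F - 1\<close>.
\<close>

definition fps_real_power :: "real fps \<Rightarrow> real \<Rightarrow> real fps" where
  "fps_real_power F t = fps_compose (fps_binomial t) (F - 1)"

text \<open>The umbra written \<open>t.\<alpha>\<close>.\<close>

definition dot_umbra :: "real \<Rightarrow> umbra \<Rightarrow> umbra" where
  "dot_umbra t \<alpha> = umbra_of_gf (fps_real_power (umbra_gf \<alpha>) t)"

lemma umbra_gf_dot_umbra: "umbra_gf (dot_umbra t \<alpha>) = fps_real_power (umbra_gf \<alpha>) t"
  unfolding dot_umbra_def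
  by (rule umbra_gf_umbra_of_gf) (simp add: fps_real_power_def)

text \<open>The umbra written \<open>\<alpha>.\<beta>.\<gamma>\<close>, where \<open>\<beta>\<close> is the Bell umbra.\<close>

definition composition_umbra :: "umbra \<Rightarrow> umbra \<Rightarrow> umbra" where
  "composition_umbra \<alpha> \<gamma> = umbra_of_gf (fps_compose (umbra_gf \<alpha>) (umbra_gf \<gamma> - 1))"

lemma umbra_gf_composition_umbra:
  "umbra_gf (composition_umbra \<alpha> \<gamma>) = fps_compose (umbra_gf \<alpha>) (umbra_gf \<gamma> - 1)"
  unfolding composition_umbra_def
  by (rule umbra_gf_umbra_of_gf) simp

definition singleton_umbra :: umbra where
  "singleton_umbra = umbra_of_gf (1 + fps_X)"

lemma umbra_gf_singleton_umbra: "umbra_gf singleton_umbra = 1 + fps_X"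
  unfolding singleton_umbra_def by (rule umbra_gf_umbra_of_gf) simp

definition compositional_inverse :: "umbra \<Rightarrow> umbra" where
  "compositional_inverse \<gamma> =
     (THE \<delta>. composition_umbra \<gamma> \<delta> = singleton_umbra \<and>
             composition_umbra \<delta> \<gamma> = singleton_umbra)"

lemma compositional_inverse_ex1:
  assumes "moment \<gamma> 1 \<noteq> 0"
  shows "\<exists>!\<delta>. composition_umbra \<gamma> \<delta> = singleton_umbra \<and>
               composition_umbra \<delta> \<gamma> = singleton_umbra"
proof -
  define U where "U = umbra_gf \<gamma> - 1"
  have U0: "fps_nth U 0 = 0" by (simp add: U_def)
  have U1: "fps_nth U 1 \<noteq> 0" using assms by (simp add: U_def umbra_gf_def)
  have gf: "umbra_gf \<gamma> = 1 + U" by (simp add: U_def)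
  have inv0: "fps_nth (fps_inv U) 0 = 0" by (simp add: fps_inv_def)
  have iff: "composition_umbra \<gamma> \<delta> = singleton_umbra \<and>
             composition_umbra \<delta> \<gamma> = singleton_umbra \<longleftrightarrow>
             fps_compose U (umbra_gf \<delta> - 1) = fps_X \<and>
             fps_compose (umbra_gf \<delta> - 1) U = fps_X" for \<delta>
    by (auto simp: umbra_gf_inject[symmetric] umbra_gf_composition_umbra
        umbra_gf_singleton_umbra gf fps_compose_add_distrib fps_compose_sub_distrib algebra_simps)
  show ?thesis
  proof (rule ex1I[of _ "umbra_of_gf (1 + fps_inv U)"])
    show "composition_umbra \<gamma> (umbra_of_gf (1 + fps_inv U)) = singleton_umbra \<and>
          composition_umbra (umbra_of_gf (1 + fps_inv U)) \<gamma> = singleton_umbra"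
      unfolding iff
      using fps_inv[OF U0 U1] fps_inv_right[OF U0 U1] inv0
      by (simp add: umbra_gf_umbra_of_gf)
  next
    fix \<delta>
    assume "composition_umbra \<gamma> \<delta> = singleton_umbra \<and>
            composition_umbra \<delta> \<gamma> = singleton_umbra"
    then have D: "fps_compose U (umbra_gf \<delta> - 1) = fps_X" unfolding iff by simp
    have "fps_compose (fps_compose (fps_inv U) U) (umbra_gf \<delta> - 1) =
          fps_compose (fps_inv U) (fps_compose U (umbra_gf \<delta> - 1))"
      by (rule fps_compose_assoc[symmetric]) (simp_all add: U0)
    then have "umbra_gf \<delta> - 1 = fps_inv U"
      by (simp add: D fps_inv[OF U0 U1])
    then have "umbra_gf \<delta> = umbra_gf (umbra_of_gf (1 + fps_inv U))"
      using inv0 by (simp add: umbra_gf_umbra_of_gf algebra_simps)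
    then show "\<delta> = umbra_of_gf (1 + fps_inv U)"
      by (simp add: umbra_gf_inject)
  qed
qed

section \<open>Conditional evaluation and time-space harmonic polynomials\<close>

text \<open>
  \<open>cond_eval \<omega> s t\<close> is the conditional evaluation \<open>E[\<cdot> | s.\<omega>]\<close>.  The argument is
  a polynomial in the symbol \<open>t.\<omega>\<close>, the result a polynomial in the symbol \<open>s.\<omega>\<close>.  The copy
  \<open>\<omega>'\<close> of \<open>\<omega>\<close> in the defining formula enters only through its moments, which are those of \<open>\<omega>\<close>.
\<close>

definition cond_eval :: "umbra \<Rightarrow> real \<Rightarrow> real \<Rightarrow> real poly \<Rightarrow> real poly" where
  "cond_eval \<omega> s t p =
     (\<Sum>k\<le>degree p. smult (coeff p k)
        (\<Sum>j\<le>k. monom (of_nat (k choose j) * moment (dot_umbra (t - s) \<omega>) (k - j)) j))"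

text \<open>
  The family \<open>A\<close> of umbrae has to be of the form \<open>{t.\<omega>}\<close>; here \<open>\<omega>\<close> is determined by \<open>A\<close>
  since \<open>1.\<omega> = \<omega>\<close>.
\<close>

definition time_space_harmonic :: "(real \<Rightarrow> real poly) \<Rightarrow> (real \<Rightarrow> umbra) \<Rightarrow> bool" where
  "time_space_harmonic P A \<longleftrightarrow>
     (\<exists>\<omega>. (\<forall>t\<ge>0. A t = dot_umbra t \<omega>) \<and>
          (\<forall>s t. 0 \<le> s \<and> s \<le> t \<longrightarrow> cond_eval \<omega> s t (P t) = P s))"

lemma dot_umbra_1 [simp]: "dot_umbra 1 \<omega> = \<omega>"
  by (simp add: umbra_gf_inject[symmetric] umbra_gf_dot_umbra fps_real_power_def
      fps_binomial_1 fps_compose_add_distrib)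

section \<open>L\'evy-Sheffer systems\<close>

definition convolution_power :: "real measure \<Rightarrow> nat \<Rightarrow> real measure" where
  "convolution_power N n = ((\<lambda>M. convolution N M) ^^ n) (return borel 0)"

definition infinitely_divisible :: "real measure \<Rightarrow> bool" where
  "infinitely_divisible M \<longleftrightarrow>
     real_distribution M \<and>
     (\<forall>n\<ge>1. \<exists>N. real_distribution N \<and> convolution_power N n = M)"

text \<open>\<open>h\<close> agrees near \<open>0\<close> with the (finite) moment generating function of \<open>M\<close>.\<close>

definition mgf_near_0 :: "real measure \<Rightarrow> (real \<Rightarrow> real) \<Rightarrow> bool" where
  "mgf_near_0 M h \<longleftrightarrow>
     (\<forall>\<^sub>F z in nhds 0. integrable M (\<lambda>x. exp (z * x)) \<and> (LINT x|M. exp (z * x)) = h z)"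

text \<open>
  All coefficients occurring here are real, so \<open>g\<close> and \<open>u\<close> are functions of a real variable and
  analyticity near \<open>0\<close> means having a convergent power series expansion there.
  The inverse \<open>\<tau>\<close> of \<open>u\<close> is determined near \<open>0\<close>.  Since \<open>g 0 = 1\<close>, \<open>g z\<close> is positive
  near \<open>0\<close>, so that \<open>powr\<close> is the usual real power there.
\<close>

definition levy_sheffer ::
  "(real \<Rightarrow> real) \<Rightarrow> (real \<Rightarrow> real) \<Rightarrow> (nat \<Rightarrow> real \<Rightarrow> real poly) \<Rightarrow> bool" where
  "levy_sheffer g u V \<longleftrightarrow>
     (\<exists>G. g has_fps_expansion G) \<and> (\<exists>U. u has_fps_expansion U) \<and>
     u 0 = 0 \<and> g 0 = 1 \<and> deriv u 0 \<noteq> 0 \<and>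
     (\<exists>\<tau> M. (\<forall>\<^sub>F z in nhds 0. \<tau> (u z) = z) \<and>
            infinitely_divisible M \<and> mgf_near_0 M (\<lambda>z. 1 / g (\<tau> z))) \<and>
     (\<forall>t\<ge>0. \<forall>x. (\<lambda>z. g z powr t * exp (x * u z)) has_fps_expansion
                   Abs_fps (\<lambda>k. poly (V k t) x / fact k))"

end

theory Submission
  imports Defs
begin

text \<open>
  Let \<open>A = f(\<alpha>, z)\<close>, \<open>U = f(\<gamma>, z) - 1\<close> and let \<open>\<rho>\<close> be the composition of \<open>\<alpha>\<close> with the
  compositional inverse of \<open>\<gamma>\<close>, so that \<open>f(\<rho>, U) = A\<close>.  Conditional evaluation of \<open>exp(x U)\<close>
  multiplies it by \<open>f(\<rho>, U)^(s - t) = A^(s - t)\<close>, which turns the generating function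
  \<open>A^t exp(x U)\<close> of the \<open>V k t\<close> into the generating function \<open>A^s exp(x U)\<close> of the \<open>V k s\<close>.
  That the analytic generating function has the formal expansion \<open>A^t exp(x U)\<close> holds because
  both satisfy \<open>A H' = (t A' + x U' A) H\<close>, which determines \<open>H\<close> from its constant term.
\<close>

section \<open>Real powers of formal power series\<close>

text \<open>The difference \<open>D\<close> of two solutions solves the same linear equation and has
  no constant term. If its lowest term had degree \<open>n > 0\<close>, coefficient
  \<open>n - 1\<close> would be \<open>n * F_0 * D_n\<close>, nonzero, on the left, and zero on the
  right.\<close>

lemma fps_ODE_unique:
  fixes H K :: "'a::field_char_0 fps"
  assumes "fps_nth F 0 \<noteq> 0"
    and "F * fps_deriv H = P * H" and "F * fps_deriv K = P * K"
    and "fps_nth H 0 = fps_nth K 0"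
  shows "H = K"
proof (rule ccontr)
  assume "H \<noteq> K"
  define D where "D = H - K"
  have D: "D \<noteq> 0" "fps_nth D 0 = 0" "F * fps_deriv D = P * D"
    using \<open>H \<noteq> K\<close> assms by (simp_all add: D_def algebra_simps)
  define n where "n = subdegree D"
  have n: "fps_nth D n \<noteq> 0" "\<And>i. i < n \<Longrightarrow> fps_nth D i = 0"
    using D(1) by (auto simp: n_def)
  then obtain m where m: "n = Suc m"
    using D(2) by (cases n) auto
  have "fps_nth (F * fps_deriv D) m = (\<Sum>i\<in>{0}. fps_nth F i * fps_nth (fps_deriv D) (m - i))"
    unfolding fps_mult_nth by (rule sum.mono_neutral_right) (auto simp: n(2) m)
  moreover have "fps_nth (P * D) m = 0"
    unfolding fps_mult_nth by (rule sum.neutral) (auto simp: n(2) m)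
  ultimately show False
    using D(3) n(1) assms(1) by (simp add: m del: of_nat_Suc)
qed

lemma fps_real_power_nth_0 [simp]: "fps_nth (fps_real_power F t) 0 = 1"
  by (simp add: fps_real_power_def)

lemma fps_real_power_add:
  assumes "fps_nth F 0 = 1"
  shows "fps_real_power F (s + t) = fps_real_power F s * fps_real_power F t"
  using assms by (simp add: fps_real_power_def fps_binomial_add_mult fps_compose_mult_distrib)

lemma fps_real_power_compose:
  assumes "fps_nth F 0 = 1" "fps_nth U 0 = 0"
  shows "fps_compose (fps_real_power F t) U = fps_real_power (fps_compose F U) t"
  using assms by (simp add: fps_real_power_def fps_compose_assoc[symmetric] fps_compose_sub_distrib)

text \<open>Substituting \<open>F - 1\<close> into \<open>(1 + X) B' = t B\<close> for the binomial
  series \<open>B\<close> and applying the chain rule gives this. Keeping the factor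
  \<open>F\<close> on the left avoids inverses and fits \<open>fps_ODE_unique\<close>.\<close>

lemma fps_real_power_deriv:
  assumes "fps_nth F 0 = 1"
  shows "F * fps_deriv (fps_real_power F t) = fps_const t * fps_deriv F * fps_real_power F t"
proof -
  define B where "B = fps_binomial t"
  have unit: "fps_nth (1 + fps_X :: real fps) 0 \<noteq> 0" by simp
  have "(1 + fps_X) * fps_deriv B = fps_const t * B * (inverse (1 + fps_X) * (1 + fps_X))"
    by (simp only: B_def fps_binomial_deriv fps_divide_unit[OF unit] mult_ac)
  then have "(1 + fps_X) * fps_deriv B = fps_const t * B"
    by (simp only: inverse_mult_eq_1[OF unit] mult_1_right)
  then have "fps_compose ((1 + fps_X) * fps_deriv B) (F - 1) = fps_compose (fps_const t * B) (F - 1)"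
    by simp
  then have *: "F * fps_compose (fps_deriv B) (F - 1) = fps_const t * fps_compose B (F - 1)"
    using assms by (simp add: fps_compose_mult_distrib fps_compose_add_distrib)
  have "fps_deriv (fps_real_power F t) = fps_compose (fps_deriv B) (F - 1) * fps_deriv F"
    using assms by (simp add: fps_real_power_def B_def fps_compose_deriv)
  with * show ?thesis
    by (simp add: fps_real_power_def B_def mult.assoc[symmetric])
qed

lemma fps_real_power_mult:
  assumes "fps_nth F 0 = 1"
  shows "fps_real_power (fps_real_power F s) t = fps_real_power F (s * t)"
proof (rule fps_ODE_unique[of F _ "fps_const (s * t) * fps_deriv F"])
  define G where "G = fps_real_power F s"
  have "G \<noteq> 0"
    by (metis G_def fps_real_power_nth_0 fps_zero_nth zero_neq_one)
  \<comment> \<open>The extra factor \<open>G\<close> allows the differential equation for powers of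
    \<open>G\<close> to be applied; it is cancelled at the end, as power series over a field have no
    zero divisors.\<close>
  have "G * (F * fps_deriv (fps_real_power G t)) = F * (G * fps_deriv (fps_real_power G t))"
    by (simp add: mult_ac)
  also have "\<dots> = fps_const t * (F * fps_deriv G) * fps_real_power G t"
    by (subst fps_real_power_deriv) (simp_all add: G_def mult_ac)
  also have "F * fps_deriv G = fps_const s * fps_deriv F * G"
    unfolding G_def by (rule fps_real_power_deriv[OF assms])
  also have "fps_const t * (fps_const s * fps_deriv F * G) * fps_real_power G t =
      G * (fps_const (s * t) * fps_deriv F * fps_real_power G t)"
    by (simp add: mult_ac flip: fps_const_mult)
  finally show "F * fps_deriv (fps_real_power (fps_real_power F s) t) =
      fps_const (s * t) * fps_deriv F * fps_real_power (fps_real_power F s) t"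
    using \<open>G \<noteq> 0\<close> by (simp add: G_def)
qed (use assms in \<open>simp_all add: fps_real_power_deriv\<close>)

text \<open>With \<open>s = -1\<close> this brings the family \<open>(-t).\<rho>\<close> into the
  form \<open>t.\<omega>\<close> that \<open>time_space_harmonic\<close> asks for.\<close>

lemma dot_umbra_dot_umbra: "dot_umbra t (dot_umbra s \<omega>) = dot_umbra (s * t) \<omega>"
  by (simp add: umbra_gf_inject[symmetric] umbra_gf_dot_umbra fps_real_power_mult)

section \<open>Expansions of real functions\<close>

lemma has_fps_expansion_imp_nth_0:
  assumes "f has_fps_expansion F"
  shows "fps_nth F 0 = f 0"
  using assms eventually_nhds_x_imp_x by (fastforce simp: has_fps_expansion_def eval_fps_at_0)

text \<open>Constant terms are values at 0, and \<open>deriv f\<close> is expanded by the formal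
  derivative. The induction therefore generalises over \<open>f\<close> and both series.\<close>

lemma has_fps_expansion_unique:
  fixes F G :: "'a::{banach,real_normed_field} fps"
  assumes "f has_fps_expansion F" "f has_fps_expansion G"
  shows "F = G"
proof -
  have "fps_nth F n = fps_nth G n" for n
    using assms
  proof (induction n arbitrary: f F G)
    case 0
    then show ?case by (simp add: has_fps_expansion_imp_nth_0)
  next
    case (Suc n)
    have "fps_nth (fps_deriv F) n = fps_nth (fps_deriv G) n"
      by (rule Suc.IH[of "deriv f"]) (intro has_fps_expansion_deriv Suc.prems)+
    then show ?case by (simp del: of_nat_Suc)
  qed
  then show ?thesis by (simp add: fps_eq_iff)
qed

lemma has_fps_expansion_cong_eventually:
  assumes "f has_fps_expansion F" "\<forall>\<^sub>F z in nhds 0. f z = g z"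
  shows "g has_fps_expansion F"
proof -
  have "\<forall>\<^sub>F z in nhds 0. eval_fps F z = f z"
    using assms(1) by (simp add: has_fps_expansion_def)
  with assms(2) have "\<forall>\<^sub>F z in nhds 0. eval_fps F z = g z"
    by eventually_elim simp
  with assms(1) show ?thesis by (simp add: has_fps_expansion_def)
qed

lemma has_fps_expansion_imp_has_field_derivative:
  fixes F :: "'a::{banach,real_normed_field} fps"
  assumes "f has_fps_expansion F"
  shows "\<forall>\<^sub>F z in nhds 0. (f has_field_derivative deriv f z) (at z)"
proof -
  have "\<forall>\<^sub>F z in nhds 0. z \<in> eball 0 (fps_conv_radius F)"
    using assms by (intro eventually_nhds_in_open)
      (auto simp: has_fps_expansion_def zero_ereal_def)
  \<comment> \<open>The derivative at \<open>z\<close> depends on \<open>f\<close> around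
    \<open>z\<close>, so agreement near 0 is turned into agreement near every point close to
    0.\<close>
  moreover have "\<forall>\<^sub>F z in nhds 0. \<forall>\<^sub>F w in nhds z. eval_fps F w = f w"
    using assms by (simp add: has_fps_expansion_def eventually_eventually)
  ultimately show ?thesis
  proof eventually_elim
    case (elim z)
    then have "(eval_fps F has_field_derivative eval_fps (fps_deriv F) z) (at z)"
      by (intro has_field_derivative_eval_fps) simp
    then have "(f has_field_derivative eval_fps (fps_deriv F) z) (at z)"
      using elim(2) by (subst (asm) DERIV_cong_ev) auto
    then show ?case
      using DERIV_imp_deriv by fastforce
  qed
qed

lemma fps_expansion_powr_exp:
  fixes g u :: "real \<Rightarrow> real"
  assumes g: "g has_fps_expansion A" "g 0 = 1"
    and u: "u has_fps_expansion U" "u 0 = 0"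
    and H: "(\<lambda>z. g z powr t * exp (x * u z)) has_fps_expansion H"
  shows "H = fps_real_power A t * fps_compose (fps_exp x) U"
proof -
  define h where "h = (\<lambda>z. g z powr t * exp (x * u z))"
  define P where "P = fps_const t * fps_deriv A + A * (fps_const x * fps_deriv U)"
  have A0: "fps_nth A 0 = 1" and U0: "fps_nth U 0 = 0"
    using has_fps_expansion_imp_nth_0[OF g(1)] has_fps_expansion_imp_nth_0[OF u(1)] g(2) u(2)
    by simp_all
  have "isCont g 0"
    using has_fps_expansion_imp_continuous[OF g(1), of UNIV] by simp
  then have "(g \<longlongrightarrow> 1) (nhds 0)"
    using g(2) by (simp add: continuous_at tendsto_nhds_iff)
  \<comment> \<open>Positivity makes \<open>powr\<close> differentiable along \<open>g\<close> and
    allows division by \<open>g z\<close>.\<close>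
  then have pos: "\<forall>\<^sub>F z in nhds 0. g z > 0"
    by (rule order_tendstoD) simp
  \<comment> \<open>This is logarithmic differentiation of \<open>h\<close>, multiplied by
    \<open>g\<close> so that the equation carries over to power series without a quotient.\<close>
  have ode: "\<forall>\<^sub>F z in nhds 0. g z * deriv h z = (t * deriv g z + g z * (x * deriv u z)) * h z"
    using pos has_fps_expansion_imp_has_field_derivative[OF g(1)]
      has_fps_expansion_imp_has_field_derivative[OF u(1)]
  proof eventually_elim
    case (elim z)
    have "((\<lambda>z. g z powr t) has_field_derivative t * g z powr (t - 1) * deriv g z) (at z)"
      using DERIV_fun_powr[OF elim(2,1), of t] by simp
    moreover have "((\<lambda>z. exp (x * u z)) has_field_derivative exp (x * u z) * (x * deriv u z)) (at z)"
      by (intro DERIV_fun_exp DERIV_cmult elim(3))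
    ultimately have "(h has_field_derivative t * g z powr (t - 1) * deriv g z * exp (x * u z) +
        exp (x * u z) * (x * deriv u z) * g z powr t) (at z)"
      unfolding h_def by (rule DERIV_mult)
    moreover have "g z powr (t - 1) = g z powr t / g z"
      using elim(1) by (simp add: powr_diff)
    ultimately have "(h has_field_derivative
        (t * deriv g z / g z + x * deriv u z) * h z) (at z)"
      by (simp add: h_def distrib_left distrib_right mult_ac)
    then have "deriv h z = (t * deriv g z / g z + x * deriv u z) * h z"
      by (rule DERIV_imp_deriv)
    with elim(1) show ?case by (simp add: field_simps)
  qed
  have h: "h has_fps_expansion H"
    using H by (simp add: h_def)
  have "(\<lambda>z. g z * deriv h z) has_fps_expansion A * fps_deriv H"
    by (rule has_fps_expansion_mult[OF g(1) has_fps_expansion_deriv[OF h]])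
  moreover have "(\<lambda>z. (t * deriv g z + g z * (x * deriv u z)) * h z) has_fps_expansion P * H"
    unfolding P_def
    by (rule has_fps_expansion_mult has_fps_expansion_add has_fps_expansion_const
        has_fps_expansion_deriv g(1) u(1) h)+
  ultimately have H': "A * fps_deriv H = P * H"
    by (rule has_fps_expansion_unique[OF has_fps_expansion_cong_eventually[OF _ ode]])
  have E': "A * fps_deriv (fps_real_power A t * fps_compose (fps_exp x) U) =
      P * (fps_real_power A t * fps_compose (fps_exp x) U)"
  proof -
    have "A * fps_deriv (fps_real_power A t * fps_compose (fps_exp x) U) =
        (A * fps_deriv (fps_real_power A t)) * fps_compose (fps_exp x) U +
        A * fps_real_power A t * fps_deriv (fps_compose (fps_exp x) U)"
      by (simp only: fps_deriv_mult distrib_left mult_ac add_ac)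
    also have "fps_deriv (fps_compose (fps_exp x) U) =
        fps_const x * fps_deriv U * fps_compose (fps_exp x) U"
      by (simp add: fps_compose_deriv U0 fps_compose_mult_distrib mult_ac)
    finally show ?thesis
      by (simp only: fps_real_power_deriv[OF A0] P_def distrib_left distrib_right mult_ac)
  qed
  have "fps_nth H 0 = 1"
    using has_fps_expansion_imp_nth_0[OF H] g(2) u(2) by simp
  then show ?thesis
    by (intro fps_ODE_unique[OF _ H' E']) (simp_all add: A0)
qed

section \<open>Conditional evaluation\<close>

text \<open>Since \<open>U ^ i\<close> has no terms below degree \<open>i\<close>, the inner sums
  may all be extended to the common range \<open>i \<le> k\<close>; then the order of summation is
  exchanged.\<close>

lemma fps_mult_compose_nth:
  fixes A B U :: "'a::comm_ring_1 fps"
  assumes "fps_nth U 0 = 0"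
  shows "fps_nth (A * fps_compose B U) k = (\<Sum>i\<le>k. fps_nth B i * fps_nth (A * U ^ i) k)"
proof -
  have "fps_nth (A * fps_compose B U) k =
      (\<Sum>m\<le>k. fps_nth A m * (\<Sum>i\<le>k - m. fps_nth B i * fps_nth (U ^ i) (k - m)))"
    by (simp add: fps_mult_nth fps_compose_nth atMost_atLeast0)
  also have "\<dots> = (\<Sum>m\<le>k. fps_nth A m * (\<Sum>i\<le>k. fps_nth B i * fps_nth (U ^ i) (k - m)))"
  proof (rule sum.cong[OF refl])
    fix m
    have "(\<Sum>i\<le>k - m. fps_nth B i * fps_nth (U ^ i) (k - m)) =
        (\<Sum>i\<le>k. fps_nth B i * fps_nth (U ^ i) (k - m))"
      using startsby_zero_power_prefix[OF assms] by (intro sum.mono_neutral_left) auto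
    then show "fps_nth A m * (\<Sum>i\<le>k - m. fps_nth B i * fps_nth (U ^ i) (k - m)) =
        fps_nth A m * (\<Sum>i\<le>k. fps_nth B i * fps_nth (U ^ i) (k - m))"
      by simp
  qed
  also have "\<dots> = (\<Sum>i\<le>k. fps_nth B i * (\<Sum>m\<le>k. fps_nth A m * fps_nth (U ^ i) (k - m)))"
    by (simp add: sum_distrib_left mult_ac) (rule sum.swap)
  finally show ?thesis
    by (simp add: fps_mult_nth atMost_atLeast0)
qed

text \<open>The binomial convolution defining the image of the \<open>i\<close>-th power is
  \<open>i!\<close> times a coefficient of a product of exponential generating functions. The bound
  \<open>n\<close> frees the sum from the actual degree of \<open>p\<close>.\<close>

lemma poly_cond_eval:
  assumes "degree p \<le> n"
  shows "poly (cond_eval \<omega> s t p) x =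
    (\<Sum>i\<le>n. coeff p i * fact i *
       fps_nth (fps_exp x * umbra_gf (dot_umbra (t - s) \<omega>)) i)"
proof -
  have *: "(\<Sum>j\<le>i. of_nat (i choose j) * moment (dot_umbra (t - s) \<omega>) (i - j) * x ^ j) =
      fact i * fps_nth (fps_exp x * umbra_gf (dot_umbra (t - s) \<omega>)) i" for i
    by (auto simp: fps_mult_nth umbra_gf_def atMost_atLeast0 sum_distrib_left
        binomial_fact field_simps intro!: sum.cong)
  have "poly (cond_eval \<omega> s t p) x =
    (\<Sum>i\<le>degree p. coeff p i * (fact i *
       fps_nth (fps_exp x * umbra_gf (dot_umbra (t - s) \<omega>)) i))"
    unfolding cond_eval_def by (simp add: poly_sum poly_monom *)
  also have "\<dots> = (\<Sum>i\<le>n. coeff p i * (fact i *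
       fps_nth (fps_exp x * umbra_gf (dot_umbra (t - s) \<omega>)) i))"
    using assms by (intro sum.mono_neutral_left) (auto simp: coeff_eq_0)
  finally show ?thesis by (simp add: mult.assoc)
qed

text \<open>Expanding \<open>exp(x U)\<close> in powers of \<open>U\<close> exhibits the
  coefficients of \<open>p\<close> and bounds its degree by \<open>k\<close>.\<close>

lemma poly_eq_sum_monom_of_sheffer:
  fixes p :: "real poly"
  assumes "\<And>x. poly p x = fact k * fps_nth (A * fps_compose (fps_exp x) U) k"
    and "fps_nth U 0 = 0"
  shows "p = (\<Sum>i\<le>k. monom (fact k / fact i * fps_nth (A * U ^ i) k) i)"
  by (rule poly_ext)
    (simp add: assms fps_mult_compose_nth poly_sum poly_monom sum_distrib_left field_simps)

lemma cond_eval_sheffer: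
  assumes p: "\<And>x. poly p x = fact k * fps_nth (A * fps_compose (fps_exp x) U) k"
    and U0: "fps_nth U 0 = 0"
  shows "poly (cond_eval \<omega> s t p) x =
    fact k * fps_nth (A * fps_compose (umbra_gf (dot_umbra (t - s) \<omega>)) U *
      fps_compose (fps_exp x) U) k"
proof -
  note p' = poly_eq_sum_monom_of_sheffer[OF p U0]
  have "degree p \<le> k"
    by (subst p', rule degree_sum_le) (auto intro: order_trans[OF degree_monom_le])
  moreover have "coeff p i = fact k / fact i * fps_nth (A * U ^ i) k" if "i \<le> k" for i
    using that by (subst p') (simp add: coeff_sum)
  ultimately have "poly (cond_eval \<omega> s t p) x =
      (\<Sum>i\<le>k. fact k *
         (fps_nth (fps_exp x * umbra_gf (dot_umbra (t - s) \<omega>)) i * fps_nth (A * U ^ i) k))"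
    by (simp add: poly_cond_eval mult_ac)
  \<comment> \<open>The coefficient formula for \<open>A * (B o U)\<close> is read backwards, now
    with \<open>B\<close> the product of the exponential and the generating function of
    \<open>(t - s).\<omega>\<close>.\<close>
  also have "\<dots> = fact k * fps_nth (A * fps_compose
      (fps_exp x * umbra_gf (dot_umbra (t - s) \<omega>)) U) k"
    by (simp only: fps_mult_compose_nth[OF U0] sum_distrib_left)
  finally show ?thesis
    by (simp add: fps_compose_mult_distrib U0 mult_ac)
qed

text \<open>The series \<open>f(\<delta>, z) - 1\<close> and \<open>f(\<gamma>, z) - 1\<close> are
  inverse under composition, so substituting the latter undoes the former.\<close>

lemma umbra_gf_composition_compositional_inverse:
  assumes "moment \<gamma> 1 \<noteq> 0"
  shows "fps_compose (umbra_gf (composition_umbra \<alpha> (compositional_inverse \<gamma>)))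
    (umbra_gf \<gamma> - 1) = umbra_gf \<alpha>"
proof -
  define \<delta> where "\<delta> = compositional_inverse \<gamma>"
  have "composition_umbra \<delta> \<gamma> = singleton_umbra"
    using theI'[OF compositional_inverse_ex1[OF assms]]
    by (simp add: \<delta>_def compositional_inverse_def)
  then have "fps_compose (umbra_gf \<delta>) (umbra_gf \<gamma> - 1) = 1 + fps_X"
    by (metis umbra_gf_composition_umbra umbra_gf_singleton_umbra)
  then have "fps_compose (umbra_gf \<delta> - 1) (umbra_gf \<gamma> - 1) = fps_X"
    by (simp add: fps_compose_sub_distrib)
  then show ?thesis
    by (simp add: umbra_gf_composition_umbra fps_compose_assoc[symmetric] flip: \<delta>_def)
qed

theorem corollary4p12:
  fixes g u :: "real \<Rightarrow> real"
    and V :: "nat \<Rightarrow> real \<Rightarrow> real poly"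
    and \<alpha> \<gamma> :: umbra
    and k :: nat
  assumes "levy_sheffer g u V"
    and "g has_fps_expansion umbra_gf \<alpha>"
    and "(\<lambda>z. 1 + u z) has_fps_expansion umbra_gf \<gamma>"
  shows "time_space_harmonic (V k)
           (\<lambda>t. dot_umbra (- t) (composition_umbra \<alpha> (compositional_inverse \<gamma>)))"
proof -
  define \<rho> where "\<rho> = composition_umbra \<alpha> (compositional_inverse \<gamma>)"
  define A where "A = umbra_gf \<alpha>"
  define U where "U = umbra_gf \<gamma> - 1"
  have U0: "fps_nth U 0 = 0" by (simp add: U_def)
  have g0: "g 0 = 1" and u0: "u 0 = 0" and u1: "deriv u 0 \<noteq> 0"
    and V: "\<And>t x. t \<ge> 0 \<Longrightarrow> (\<lambda>z. g z powr t * exp (x * u z)) has_fps_expansion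
                   Abs_fps (\<lambda>k. poly (V k t) x / fact k)"
    using assms(1) unfolding levy_sheffer_def by blast+
  have "(\<lambda>z. 1 + u z - 1) has_fps_expansion U"
    unfolding U_def by (intro fps_expansion_intros assms(3))
  then have u: "u has_fps_expansion U" by simp
  have "deriv u 0 = fps_nth (fps_deriv U) 0"
    using has_fps_expansion_imp_nth_0[OF has_fps_expansion_deriv[OF u]] by simp
  \<comment> \<open>The first moment of \<open>\<gamma>\<close> is the linear coefficient of
    \<open>U\<close>, hence \<open>u'(0)\<close>; its being nonzero ensures that the compositional
    inverse exists.\<close>
  with u1 have "moment \<gamma> 1 \<noteq> 0"
    by (simp add: U_def umbra_gf_def)
  then have \<rho>: "fps_compose (umbra_gf \<rho>) U = A"
    unfolding \<rho>_def U_def A_def by (rule umbra_gf_composition_compositional_inverse)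
  have gf: "poly (V k t) x = fact k * fps_nth (fps_real_power A t * fps_compose (fps_exp x) U) k"
    if "t \<ge> 0" for t x
    using fps_expansion_powr_exp[OF assms(2) g0 u u0 V[OF that, of x]]
    by (simp add: fps_eq_iff A_def field_simps)
  \<comment> \<open>The witness is \<open>\<omega> = (-1).\<rho>\<close>. Then
    \<open>(t - s).\<omega>\<close> has generating function \<open>f(\<rho>, z)^(s - t)\<close>, and
    the exponents \<open>t\<close> and \<open>s - t\<close> add up to \<open>s\<close>.\<close>
  have "cond_eval (dot_umbra (- 1) \<rho>) s t (V k t) = V k s" if st: "0 \<le> s" "s \<le> t" for s t
  proof (rule poly_ext)
    fix x
    have "fps_real_power A t * fps_compose (umbra_gf (dot_umbra (t - s) (dot_umbra (- 1) \<rho>))) U =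
        fps_real_power A t * fps_real_power A (s - t)"
      by (simp add: dot_umbra_dot_umbra umbra_gf_dot_umbra fps_real_power_compose U0 \<rho>)
    also have "\<dots> = fps_real_power A s"
      by (simp add: A_def flip: fps_real_power_add)
    finally show "poly (cond_eval (dot_umbra (- 1) \<rho>) s t (V k t)) x = poly (V k s) x"
      using st by (simp add: cond_eval_sheffer[OF gf U0] gf)
  qed
  then show ?thesis
    unfolding time_space_harmonic_def \<rho>_def[symmetric]
    by (intro exI[of _ "dot_umbra (- 1) \<rho>"]) (simp add: dot_umbra_dot_umbra)
qed

end
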